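(* Let $R$ be a ring, let $n$ be a positive integer, let $\sigma\colon R\to M_n(R)$ be a ring homomorphism and let $\delta\colon R\to R^n$ be a right $\sigma$-derivation. Then there exists a $(\sigma,\delta)$-free skew extension of $R$ generated by $n$ elements.
   Context: Rings are associative with identity element; ring homomorphisms preserve the identity; modules are unital. An $R$-ring is a ring $A$ together with a ring homomorphism $\lambda_A\colon R\to A$; it is an $R$-bimodule via $ra=\lambda_A(r)a$, $ar=a\lambda_A(r)$, and in expressions inside $A$ an element $r\in R$ stands for $\lambda_A(r)$. $R^n$ denotes the free left $R$-module of row vectors with $n$ entries in $R$. For a ring homomorphism $\sigma\colon R\to M_n(R)$, a right $\sigma$-derivation is an additive map $\delta\colon R\to R^n$ with $\delta(rs)=\delta(r)\sigma(s)+r\delta(s)$ for all $r,s\in R$ (matrix product in the first term). Write $\sigma_{ij}(r)$ for the $(i,j)$-entry of $\sigma(r)$ and $\delta_j(r)$ for the $j$-th component of $\delta(r)$. A $(\sigma,\delta)$-free skew extension of $R$ generated by $X=\{x_1,\dots,x_n\}$ is an $R$-ring $S$ containing an $n$-element subset $X=\{x_1,\dots,x_n\}$ such that (i) the submonoid $\langle X\rangle$ of the multiplicative monoid of $S$ generated by $X$ is free on $X$; (ii) $S$ is a free right $R$-module with basis $\langle X\rangle$; (iii) $rx_j=\sum_{i=1}^n x_i\sigma_{ij}(r)+\delta_j(r)$ for all $j=1,\dots,n$ and $r\in R$.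
   Formalization: The ring R is assumed to be nonzero (1 ≠ 0); for the zero ring every R-ring is zero, so no element set can generate a free monoid and the claim fails. *)

theory Defs
  imports "HOL-Algebra.Module"
begin

text \<open>
  Vectors and matrices of size \<open>n\<close> are functions on the index set \<open>{1..n}\<close>, taken extensional
  (that is, \<open>undefined\<close> outside \<open>{1..n}\<close>) so that equality is equality of entries.
\<close>

definition mat_ring :: "('a, 'm) ring_scheme \<Rightarrow> nat \<Rightarrow> (nat \<Rightarrow> nat \<Rightarrow> 'a) ring" where
  "mat_ring R n =
    \<lparr>carrier = {1..n} \<rightarrow>\<^sub>E {1..n} \<rightarrow>\<^sub>E carrier R,
     mult = (\<lambda>A B. \<lambda>i\<in>{1..n}. \<lambda>j\<in>{1..n}. \<Oplus>\<^bsub>R\<^esub>k\<in>{1..n}. A i k \<otimes>\<^bsub>R\<^esub> B k j),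
     one = (\<lambda>i\<in>{1..n}. \<lambda>j\<in>{1..n}. if i = j then \<one>\<^bsub>R\<^esub> else \<zero>\<^bsub>R\<^esub>),
     zero = (\<lambda>i\<in>{1..n}. \<lambda>j\<in>{1..n}. \<zero>\<^bsub>R\<^esub>),
     add = (\<lambda>A B. \<lambda>i\<in>{1..n}. \<lambda>j\<in>{1..n}. A i j \<oplus>\<^bsub>R\<^esub> B i j)\<rparr>"

text \<open>
  The free left module of row vectors. The locale \<open>module\<close> of HOL-Algebra requires a commutative
  ring of scalars, so only its record type is used; the multiplicative fields of that record have
  no meaning for a module.
\<close>

definition row_module :: "('a, 'm) ring_scheme \<Rightarrow> nat \<Rightarrow> ('a, nat \<Rightarrow> 'a) module" where
  "row_module R n =
    \<lparr>carrier = {1..n} \<rightarrow>\<^sub>E carrier R,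
     mult = undefined, one = undefined,
     zero = (\<lambda>j\<in>{1..n}. \<zero>\<^bsub>R\<^esub>),
     add = (\<lambda>v w. \<lambda>j\<in>{1..n}. v j \<oplus>\<^bsub>R\<^esub> w j),
     smult = (\<lambda>r v. \<lambda>j\<in>{1..n}. r \<otimes>\<^bsub>R\<^esub> v j)\<rparr>"

definition row_mat_mult ::
    "('a, 'm) ring_scheme \<Rightarrow> nat \<Rightarrow> (nat \<Rightarrow> 'a) \<Rightarrow> (nat \<Rightarrow> nat \<Rightarrow> 'a) \<Rightarrow> nat \<Rightarrow> 'a" where
  "row_mat_mult R n v A = (\<lambda>j\<in>{1..n}. \<Oplus>\<^bsub>R\<^esub>i\<in>{1..n}. v i \<otimes>\<^bsub>R\<^esub> A i j)"

definition right_skew_derivation ::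
    "('a, 'm) ring_scheme \<Rightarrow> nat \<Rightarrow> ('a \<Rightarrow> nat \<Rightarrow> nat \<Rightarrow> 'a) \<Rightarrow> ('a \<Rightarrow> nat \<Rightarrow> 'a) \<Rightarrow> bool" where
  "right_skew_derivation R n \<sigma> \<delta> \<longleftrightarrow>
     \<delta> \<in> hom (add_monoid R) (add_monoid (row_module R n)) \<and>
     (\<forall>r\<in>carrier R. \<forall>s\<in>carrier R.
        \<delta> (r \<otimes>\<^bsub>R\<^esub> s) =
          row_mat_mult R n (\<delta> r) (\<sigma> s) \<oplus>\<^bsub>row_module R n\<^esub> r \<odot>\<^bsub>row_module R n\<^esub> \<delta> s)"

definition R_ring :: "('a, 'm) ring_scheme \<Rightarrow> ('b, 'k) ring_scheme \<Rightarrow> ('a \<Rightarrow> 'b) \<Rightarrow> bool" where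
  "R_ring R A l \<longleftrightarrow> ring R \<and> ring A \<and> l \<in> ring_hom R A"

definition generated_submonoid :: "('b, 'k) monoid_scheme \<Rightarrow> 'b set \<Rightarrow> 'b set" where
  "generated_submonoid M X = \<Inter>{N. submonoid N M \<and> X \<subseteq> N}"

definition word_monoid :: "'b set \<Rightarrow> 'b list monoid" where
  "word_monoid X = \<lparr>carrier = lists X, mult = (@), one = []\<rparr>"

definition word_eval :: "('b, 'k) monoid_scheme \<Rightarrow> 'b list \<Rightarrow> 'b" where
  "word_eval M w = foldr (mult M) w \<one>\<^bsub>M\<^esub>"

text \<open>
  The submonoid generated by \<open>X\<close> is free on \<open>X\<close>: the canonical map from words over \<open>X\<close>, sending
  a word to its product, is an isomorphism onto it.
\<close>

definition freely_generates_submonoid :: "('b, 'k) monoid_scheme \<Rightarrow> 'b set \<Rightarrow> bool" where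
  "freely_generates_submonoid M X \<longleftrightarrow>
     word_eval M \<in> iso (word_monoid X) (M\<lparr>carrier := generated_submonoid M X\<rparr>)"

text \<open>
  An \<open>R\<close>-ring \<open>A\<close> with structure map \<open>l\<close> is a right \<open>R\<close>-module via \<open>a \<cdot> r = a \<otimes> l r\<close>; the two
  clauses after the inclusion are spanning and linear independence for this action.
\<close>

definition right_module_basis ::
    "('a, 'm) ring_scheme \<Rightarrow> ('b, 'k) ring_scheme \<Rightarrow> ('a \<Rightarrow> 'b) \<Rightarrow> 'b set \<Rightarrow> bool" where
  "right_module_basis R A l B \<longleftrightarrow>
     B \<subseteq> carrier A \<and>
     (\<forall>a\<in>carrier A. \<exists>F c. finite F \<and> F \<subseteq> B \<and> c \<in> F \<rightarrow> carrier R \<and>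
        a = (\<Oplus>\<^bsub>A\<^esub>b\<in>F. b \<otimes>\<^bsub>A\<^esub> l (c b))) \<and>
     (\<forall>F c. finite F \<and> F \<subseteq> B \<and> c \<in> F \<rightarrow> carrier R \<and>
        (\<Oplus>\<^bsub>A\<^esub>b\<in>F. b \<otimes>\<^bsub>A\<^esub> l (c b)) = \<zero>\<^bsub>A\<^esub> \<longrightarrow> (\<forall>b\<in>F. c b = \<zero>\<^bsub>R\<^esub>))"

text \<open>\<open>S\<close> is the ring, \<open>l\<close> its structure map and \<open>x 1, \<dots>, x n\<close> the distinct generators.\<close>

definition free_skew_extension ::
    "('a, 'm) ring_scheme \<Rightarrow> nat \<Rightarrow> ('a \<Rightarrow> nat \<Rightarrow> nat \<Rightarrow> 'a) \<Rightarrow> ('a \<Rightarrow> nat \<Rightarrow> 'a) \<Rightarrow>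
     ('b, 'k) ring_scheme \<Rightarrow> ('a \<Rightarrow> 'b) \<Rightarrow> (nat \<Rightarrow> 'b) \<Rightarrow> bool" where
  "free_skew_extension R n \<sigma> \<delta> S l x \<longleftrightarrow>
     R_ring R S l \<and>
     x ` {1..n} \<subseteq> carrier S \<and> inj_on x {1..n} \<and>
     freely_generates_submonoid S (x ` {1..n}) \<and>
     right_module_basis R S l (generated_submonoid S (x ` {1..n})) \<and>
     (\<forall>r\<in>carrier R. \<forall>j\<in>{1..n}.
        l r \<otimes>\<^bsub>S\<^esub> x j = (\<Oplus>\<^bsub>S\<^esub>i\<in>{1..n}. x i \<otimes>\<^bsub>S\<^esub> l (\<sigma> r i j)) \<oplus>\<^bsub>S\<^esub> l (\<delta> r j))"

end

theory Submission
  imports Defs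
begin

text \<open>
  Let \<open>D\<close> be the free right \<open>R\<close>-module on the words over \<open>{1..n}\<close>, and let \<open>x\<^sub>j\<close> act on it by
  prefixing the letter \<open>j\<close>. Recursion on words gives operators \<open>r \<cdot> _\<close> on \<open>D\<close> with
  \<open>r \<cdot> x\<^sub>j f = (\<Sum>i. x\<^sub>i (\<sigma>\<^sub>i\<^sub>j(r) \<cdot> f)) + \<delta>\<^sub>j(r) \<cdot> f\<close>; the multiplicativity of \<open>\<sigma>\<close> and the derivation
  rule for \<open>\<delta>\<close> say exactly that \<open>r \<cdot> (s \<cdot> f) = rs \<cdot> f\<close>. So \<open>D\<close> is a left \<open>R\<close>-module, and putting
  \<open>(w r) g = w (r \<cdot> g)\<close> for a word \<open>w\<close> multiplies elements of \<open>D\<close>. Associativity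
  reduces to \<open>(r \<cdot> f) g = r \<cdot> (f g)\<close>, which follows by induction on \<open>f\<close> from the recursion formula.
\<close>

section \<open>Additive maps between abelian groups\<close>

definition add_hom :: "('a, 'm) ring_scheme \<Rightarrow> ('b, 'k) ring_scheme \<Rightarrow> ('a \<Rightarrow> 'b) set" where
  "add_hom A B = hom (add_monoid A) (add_monoid B)"

lemma add_homI:
  assumes "\<And>x. x \<in> carrier A \<Longrightarrow> h x \<in> carrier B"
    and "\<And>x y. \<lbrakk>x \<in> carrier A; y \<in> carrier A\<rbrakk> \<Longrightarrow> h (x \<oplus>\<^bsub>A\<^esub> y) = h x \<oplus>\<^bsub>B\<^esub> h y"
  shows "h \<in> add_hom A B"
  using assms by (auto simp: add_hom_def hom_def)

lemma add_hom_closed: "h \<in> add_hom A B \<Longrightarrow> x \<in> carrier A \<Longrightarrow> h x \<in> carrier B"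
  by (auto simp: add_hom_def hom_def)

lemma add_hom_add:
  "h \<in> add_hom A B \<Longrightarrow> x \<in> carrier A \<Longrightarrow> y \<in> carrier A \<Longrightarrow> h (x \<oplus>\<^bsub>A\<^esub> y) = h x \<oplus>\<^bsub>B\<^esub> h y"
  by (auto simp: add_hom_def hom_def)

lemma add_hom_zero:
  assumes "abelian_group A" "abelian_group B" "h \<in> add_hom A B"
  shows "h \<zero>\<^bsub>A\<^esub> = \<zero>\<^bsub>B\<^esub>"
  using hom_one[OF assms(3)[unfolded add_hom_def]] assms(1,2) by (simp add: abelian_group.a_group)

lemma add_hom_finsum:
  assumes A: "abelian_group A" and B: "abelian_group B" and h: "h \<in> add_hom A B"
    and "finite F" "g \<in> F \<rightarrow> carrier A"
  shows "h (finsum A g F) = finsum B (\<lambda>i. h (g i)) F"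
proof -
  interpret A: abelian_group A by fact
  interpret B: abelian_group B by fact
  show ?thesis using assms(4,5)
  proof (induction F rule: finite_induct)
    case empty
    show ?case by (simp add: add_hom_zero[OF A B h])
  next
    case (insert x F)
    then have "g \<in> F \<rightarrow> carrier A" "g x \<in> carrier A" by auto
    then show ?case
      using insert by (simp add: add_hom_add[OF h] add_hom_closed[OF h] Pi_iff)
  qed
qed

lemma add_hom_finsum_fun:
  assumes "abelian_group B" and "\<And>i. i \<in> F \<Longrightarrow> h i \<in> add_hom A B"
  shows "(\<lambda>x. finsum B (\<lambda>i. h i x) F) \<in> add_hom A B"
proof -
  interpret B: abelian_group B by fact
  have cl: "h i x \<in> carrier B" if "i \<in> F" "x \<in> carrier A" for i x
    using add_hom_closed[OF assms(2)] that .
  show ?thesis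
  proof (rule add_homI)
    fix x y assume xy: "x \<in> carrier A" "y \<in> carrier A"
    have "finsum B (\<lambda>i. h i (x \<oplus>\<^bsub>A\<^esub> y)) F = finsum B (\<lambda>i. h i x \<oplus>\<^bsub>B\<^esub> h i y) F"
      using xy cl by (intro B.finsum_cong') (auto intro: add_hom_add[OF assms(2)])
    then show "finsum B (\<lambda>i. h i (x \<oplus>\<^bsub>A\<^esub> y)) F
        = finsum B (\<lambda>i. h i x) F \<oplus>\<^bsub>B\<^esub> finsum B (\<lambda>i. h i y) F"
      using cl xy by (simp add: Pi_iff)
  qed (use cl in \<open>auto intro!: B.finsum_closed\<close>)
qed

lemma add_hom_add_fun:
  assumes "abelian_group B" "h \<in> add_hom A B" "k \<in> add_hom A B"
  shows "(\<lambda>x. h x \<oplus>\<^bsub>B\<^esub> k x) \<in> add_hom A B"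
proof -
  interpret B: abelian_group B by fact
  show ?thesis
    using assms(2,3)
    by (intro add_homI)
      (simp_all add: add_hom_add[OF assms(2)] add_hom_add[OF assms(3)]
        add_hom_closed[OF assms(2)] add_hom_closed[OF assms(3)] B.a_ac)
qed

lemma add_hom_comp:
  "h \<in> add_hom A B \<Longrightarrow> k \<in> add_hom B C \<Longrightarrow> (\<lambda>x. k (h x)) \<in> add_hom A C"
  by (auto simp: add_hom_def hom_def Pi_iff)

lemma (in abelian_monoid) finsum_swap:
  assumes "finite A" "finite B" and "\<And>i j. i \<in> A \<Longrightarrow> j \<in> B \<Longrightarrow> f i j \<in> carrier G"
  shows "(\<Oplus>i\<in>A. \<Oplus>j\<in>B. f i j) = (\<Oplus>j\<in>B. \<Oplus>i\<in>A. f i j)"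
  using assms(1,3)
proof (induction A rule: finite_induct)
  case (insert a A)
  then have "(\<Oplus>j\<in>B. \<Oplus>i\<in>insert a A. f i j) = (\<Oplus>j\<in>B. f a j \<oplus> (\<Oplus>i\<in>A. f i j))"
    by (intro finsum_cong') (auto simp: Pi_iff)
  then show ?case using insert by (simp add: Pi_iff)
qed simp


subsection \<open>Finitely supported functions\<close>

text \<open>The direct sum of copies of \<open>R\<close> indexed by \<open>J\<close>. The ring
  record makes the theory of abelian groups and finite sums available; a product and a unit come
  only with \<open>S\<close>.\<close>

definition finsupp_group :: "('a, 'm) ring_scheme \<Rightarrow> 'i set \<Rightarrow> ('i \<Rightarrow> 'a) ring" where
  "finsupp_group R J =
    \<lparr>carrier = {f. range f \<subseteq> carrier R \<and> finite {w. f w \<noteq> \<zero>\<^bsub>R\<^esub>} \<and> {w. f w \<noteq> \<zero>\<^bsub>R\<^esub>} \<subseteq> J},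
     mult = undefined, one = undefined,
     zero = (\<lambda>w. \<zero>\<^bsub>R\<^esub>),
     add = (\<lambda>f g w. f w \<oplus>\<^bsub>R\<^esub> g w)\<rparr>"

definition single :: "('a, 'm) ring_scheme \<Rightarrow> 'i \<Rightarrow> 'a \<Rightarrow> 'i \<Rightarrow> 'a" where
  "single R w r = (\<lambda>v. if v = w then r else \<zero>\<^bsub>R\<^esub>)"

text \<open>The map out of the direct sum induced by the family \<open>\<phi>\<close>;
  \<open>lift_add_hom\<close> and \<open>lift_single\<close> give the existence half of its
  universal property.\<close>

definition lift :: "('a, 'm) ring_scheme \<Rightarrow> ('b, 'k) ring_scheme \<Rightarrow> ('i \<Rightarrow> 'a \<Rightarrow> 'b) \<Rightarrow> ('i \<Rightarrow> 'a) \<Rightarrow> 'b"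
  where "lift R M \<phi> f = (\<Oplus>\<^bsub>M\<^esub>w\<in>{w. f w \<noteq> \<zero>\<^bsub>R\<^esub>}. \<phi> w (f w))"

lemma finsupp_simps [simp]:
  "zero (finsupp_group R J) = (\<lambda>w. \<zero>\<^bsub>R\<^esub>)"
  "f \<oplus>\<^bsub>finsupp_group R J\<^esub> g = (\<lambda>w. f w \<oplus>\<^bsub>R\<^esub> g w)"
  by (simp_all add: finsupp_group_def)

lemma finsupp_carrier:
  "f \<in> carrier (finsupp_group R J) \<longleftrightarrow>
     (\<forall>w. f w \<in> carrier R) \<and> finite {w. f w \<noteq> \<zero>\<^bsub>R\<^esub>} \<and> {w. f w \<noteq> \<zero>\<^bsub>R\<^esub>} \<subseteq> J"
  by (auto simp: finsupp_group_def)

context abelian_group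
begin

lemma finsupp_group_abelian: "abelian_group (finsupp_group G J)"
proof (rule abelian_groupI)
  fix f g assume "f \<in> carrier (finsupp_group G J)" "g \<in> carrier (finsupp_group G J)"
  moreover have "{w. f w \<oplus> g w \<noteq> \<zero>} \<subseteq> {w. f w \<noteq> \<zero>} \<union> {w. g w \<noteq> \<zero>}" by auto
  ultimately show "f \<oplus>\<^bsub>finsupp_group G J\<^esub> g \<in> carrier (finsupp_group G J)"
    unfolding finsupp_carrier by (auto intro: finite_subset)
next
  fix f assume f: "f \<in> carrier (finsupp_group G J)"
  then have "{w. \<ominus> f w \<noteq> \<zero>} = {w. f w \<noteq> \<zero>}"
    by (simp add: finsupp_carrier add.inv_eq_1_iff)
  with f show "\<exists>g\<in>carrier (finsupp_group G J). g \<oplus>\<^bsub>finsupp_group G J\<^esub> f = \<zero>\<^bsub>finsupp_group G J\<^esub>"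
    by (intro bexI[of _ "\<lambda>w. \<ominus> f w"]) (auto simp: finsupp_carrier l_neg)
qed (auto simp: finsupp_carrier a_ac)

lemma single_closed: "w \<in> J \<Longrightarrow> r \<in> carrier G \<Longrightarrow> single G w r \<in> carrier (finsupp_group G J)"
  by (auto simp: finsupp_carrier single_def)

lemma single_add:
  "r \<in> carrier G \<Longrightarrow> s \<in> carrier G \<Longrightarrow>
    single G w (r \<oplus> s) = single G w r \<oplus>\<^bsub>finsupp_group G J\<^esub> single G w s"
  by (auto simp: single_def)

lemma single_zero: "single G w \<zero> = \<zero>\<^bsub>finsupp_group G J\<^esub>"
  by (auto simp: single_def)

lemma finsum_finsupp_apply:
  assumes "finite F" "g \<in> F \<rightarrow> carrier (finsupp_group G J)"
  shows "finsum (finsupp_group G J) g F v = (\<Oplus>w\<in>F. g w v)"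
proof -
  have "(\<lambda>f. f v) \<in> add_hom (finsupp_group G J) G"
    by (rule add_homI) (auto simp: finsupp_carrier)
  from add_hom_finsum[OF finsupp_group_abelian abelian_group_axioms this assms] show ?thesis .
qed

text \<open>Evaluation at \<open>v\<close> is additive, and only the summand with
  \<open>w = v\<close> survives it. Both the expansion into monomials and their linear independence
  rest on this.\<close>

lemma finsum_single_apply:
  assumes "finite F" "F \<subseteq> J" "f \<in> F \<rightarrow> carrier G"
  shows "(\<Oplus>\<^bsub>finsupp_group G J\<^esub>w\<in>F. single G w (f w)) v = (if v \<in> F then f v else \<zero>)"
proof -
  have "(\<Oplus>\<^bsub>finsupp_group G J\<^esub>w\<in>F. single G w (f w)) v = (\<Oplus>w\<in>F. if v = w then f w else \<zero>)"
    using assms by (subst finsum_finsupp_apply) (auto intro!: single_closed, simp add: single_def)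
  also have "\<dots> = (if v \<in> F then f v else \<zero>)"
  proof (cases "v \<in> F")
    case True
    then show ?thesis using assms finsum_singleton[of v F f] by simp
  next
    case False
    then have "(\<Oplus>w\<in>F. if v = w then f w else \<zero>) = (\<Oplus>w\<in>F. \<zero>)"
      by (intro finsum_cong') auto
    then show ?thesis using False by simp
  qed
  finally show ?thesis .
qed

lemma finsupp_expansion:
  assumes "f \<in> carrier (finsupp_group G J)"
  shows "f = (\<Oplus>\<^bsub>finsupp_group G J\<^esub>w\<in>{w. f w \<noteq> \<zero>}. single G w (f w))"
  using assms by (intro ext) (subst finsum_single_apply, auto simp: finsupp_carrier)

text \<open>By \<open>finsupp_expansion\<close> it suffices to treat partial sums of the expansion
  of \<open>f\<close>, one monomial at a time.\<close>

lemma finsupp_induct [consumes 1, case_names zero single add]: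
  assumes f: "f \<in> carrier (finsupp_group G J)"
    and zero: "P \<zero>\<^bsub>finsupp_group G J\<^esub>"
    and single: "\<And>w r. w \<in> J \<Longrightarrow> r \<in> carrier G \<Longrightarrow> P (single G w r)"
    and add: "\<And>f g. \<lbrakk>f \<in> carrier (finsupp_group G J); g \<in> carrier (finsupp_group G J); P f; P g\<rbrakk>
                \<Longrightarrow> P (f \<oplus>\<^bsub>finsupp_group G J\<^esub> g)"
  shows "P f"
proof -
  interpret D: abelian_group "finsupp_group G J" by (rule finsupp_group_abelian)
  have "P (\<Oplus>\<^bsub>finsupp_group G J\<^esub>w\<in>F. single G w (f w))" if "finite F" "F \<subseteq> J" for F
    using that
  proof (induction F rule: finite_induct)
    case empty
    show ?case using zero by (simp only: D.finsum_empty)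
  next
    case (insert w F)
    have "(\<lambda>w. single G w (f w)) \<in> F \<rightarrow> carrier (finsupp_group G J)"
      using insert f by (auto intro!: single_closed simp: finsupp_carrier[of f])
    moreover have "w \<in> J" "f w \<in> carrier G"
      using insert f by (auto simp: finsupp_carrier[of f])
    moreover from this have "single G w (f w) \<in> carrier (finsupp_group G J)"
      by (rule single_closed)
    ultimately show ?case
      using insert by (subst D.finsum_insert) (auto intro!: add single D.finsum_closed simp del: finsupp_simps)
  qed
  then show ?thesis
    using f by (subst finsupp_expansion[OF f]) (simp add: finsupp_carrier)
qed

context
  fixes M :: "('c, 'k) ring_scheme" and J :: "'i set" and \<phi> :: "'i \<Rightarrow> 'a \<Rightarrow> 'c"
  assumes M: "abelian_group M" and \<phi>: "\<And>w. w \<in> J \<Longrightarrow> \<phi> w \<in> add_hom G M"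
begin

interpretation M: abelian_group M by (rule M)

private lemma \<phi>_closed:
  "f \<in> carrier (finsupp_group G J) \<Longrightarrow> w \<in> J \<Longrightarrow> \<phi> w (f w) \<in> carrier M"
  by (rule add_hom_closed[OF \<phi>]) (auto simp: finsupp_carrier)

text \<open>The extra terms vanish because each \<open>\<phi> w\<close> is additive, so sums over
  different supports can be compared on one index set.\<close>

private lemma lift_superset:
  assumes "f \<in> carrier (finsupp_group G J)" "finite F" "{w. f w \<noteq> \<zero>} \<subseteq> F" "F \<subseteq> J"
  shows "lift G M \<phi> f = (\<Oplus>\<^bsub>M\<^esub>w\<in>F. \<phi> w (f w))"
  unfolding lift_def
proof (rule M.add.finprod_mono_neutral_cong_left)
  show "(\<lambda>w. \<phi> w (f w)) \<in> F \<rightarrow> carrier M"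
    using assms \<phi>_closed by blast
  show "\<And>w. w \<in> F - {w. f w \<noteq> \<zero>} \<Longrightarrow> \<phi> w (f w) = \<zero>\<^bsub>M\<^esub>"
    using assms add_hom_zero[OF abelian_group_axioms M \<phi>] by auto
qed (use assms in auto)

lemma lift_add_hom: "lift G M \<phi> \<in> add_hom (finsupp_group G J) M"
proof (rule add_homI)
  fix f assume f: "f \<in> carrier (finsupp_group G J)"
  then show "lift G M \<phi> f \<in> carrier M"
    unfolding lift_def using \<phi>_closed[OF f] by (intro M.finsum_closed) (auto simp: finsupp_carrier)
next
  fix f g assume f: "f \<in> carrier (finsupp_group G J)" and g: "g \<in> carrier (finsupp_group G J)"
  interpret D: abelian_group "finsupp_group G J" by (rule finsupp_group_abelian)
  \<comment> \<open>Cancellation can make the support of the sum smaller than this union, so all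
    three lifts are computed over the union.\<close>
  let ?F = "{w. f w \<noteq> \<zero>} \<union> {w. g w \<noteq> \<zero>}"
  have F: "finite ?F" "?F \<subseteq> J" using f g by (auto simp: finsupp_carrier)
  have fg: "f \<oplus>\<^bsub>finsupp_group G J\<^esub> g \<in> carrier (finsupp_group G J)" using f g by (rule D.a_closed)
  have cl: "\<And>w. w \<in> J \<Longrightarrow> \<phi> w (f w) \<in> carrier M" "\<And>w. w \<in> J \<Longrightarrow> \<phi> w (g w) \<in> carrier M"
    using f g \<phi>_closed by auto
  have "lift G M \<phi> (f \<oplus>\<^bsub>finsupp_group G J\<^esub> g) = (\<Oplus>\<^bsub>M\<^esub>w\<in>?F. \<phi> w (f w \<oplus> g w))"
    using f g F by (subst lift_superset[OF fg F(1) _ F(2)]) (auto simp: finsupp_carrier)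
  also have "\<dots> = (\<Oplus>\<^bsub>M\<^esub>w\<in>?F. \<phi> w (f w) \<oplus>\<^bsub>M\<^esub> \<phi> w (g w))"
    using f g F cl by (intro M.finsum_cong') (auto simp: finsupp_carrier intro!: add_hom_add[OF \<phi>])
  also have "\<dots> = lift G M \<phi> f \<oplus>\<^bsub>M\<^esub> lift G M \<phi> g"
    using F cl by (subst M.finsum_addf) (auto simp: lift_superset[OF f F(1) _ F(2)] lift_superset[OF g F(1) _ F(2)])
  finally show "lift G M \<phi> (f \<oplus>\<^bsub>finsupp_group G J\<^esub> g) = lift G M \<phi> f \<oplus>\<^bsub>M\<^esub> lift G M \<phi> g" .
qed

lemma lift_single:
  assumes w: "w \<in> J" and r: "r \<in> carrier G"
  shows "lift G M \<phi> (single G w r) = \<phi> w r"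
proof -
  have "lift G M \<phi> (single G w r) = (\<Oplus>\<^bsub>M\<^esub>v\<in>{w}. \<phi> v (single G w r v))"
    using w r by (intro lift_superset single_closed) (auto simp: single_def)
  also have "\<dots> = \<phi> w r"
    using w r add_hom_closed[OF \<phi>] by (simp add: single_def)
  finally show ?thesis .
qed

end

end

text \<open>The uniqueness half of the universal property: monomials generate the direct sum
  additively, so identities between additive maps need checking only there.\<close>

lemma (in abelian_group) finsupp_add_hom_eqI:
  assumes M: "abelian_group M"
    and h: "h \<in> add_hom (finsupp_group G J) M" and k: "k \<in> add_hom (finsupp_group G J) M"
    and eq: "\<And>w r. w \<in> J \<Longrightarrow> r \<in> carrier G \<Longrightarrow> h (single G w r) = k (single G w r)"
    and f: "f \<in> carrier (finsupp_group G J)"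
  shows "h f = k f"
  using f
proof (induction rule: finsupp_induct)
  case zero
  show ?case
    using add_hom_zero[OF finsupp_group_abelian M h] add_hom_zero[OF finsupp_group_abelian M k]
    by (simp only:)
next
  case (add f g)
  then show ?case by (simp only: add_hom_add[OF h] add_hom_add[OF k])
qed (rule eq)

declare finsupp_simps [simp del]


subsection \<open>Submonoids generated by a set\<close>

context monoid
begin

lemma word_eval_closed: "w \<in> lists X \<Longrightarrow> X \<subseteq> carrier G \<Longrightarrow> word_eval G w \<in> carrier G"
  by (induction w) (auto simp: word_eval_def)

lemma word_eval_append:
  assumes "v \<in> lists X" "w \<in> lists X" "X \<subseteq> carrier G"
  shows "word_eval G (v @ w) = word_eval G v \<otimes> word_eval G w"
  using assms
proof (induction v)
  case Nil
  then show ?case using word_eval_closed[of w X] by (simp add: word_eval_def)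
next
  case (Cons a v)
  then show ?case
    using word_eval_closed[of w X] word_eval_closed[of v X]
    by (auto simp: word_eval_def m_assoc)
qed

text \<open>The products of words form a submonoid containing \<open>X\<close>, and induction on the
  word puts each product into every such submonoid.\<close>

lemma generated_submonoid_eq:
  assumes X: "X \<subseteq> carrier G"
  shows "generated_submonoid G X = word_eval G ` lists X"
proof
  have "submonoid (word_eval G ` lists X) G"
  proof
    show "word_eval G ` lists X \<subseteq> carrier G" using word_eval_closed X by blast
    show "\<one> \<in> word_eval G ` lists X" by (rule image_eqI[of _ _ "[]"]) (auto simp: word_eval_def)
    fix a b assume "a \<in> word_eval G ` lists X" "b \<in> word_eval G ` lists X"
    then obtain v w where "v \<in> lists X" "w \<in> lists X" "a = word_eval G v" "b = word_eval G w"
      by blast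
    then show "a \<otimes> b \<in> word_eval G ` lists X"
      using X by (intro image_eqI[of _ _ "v @ w"]) (auto simp: word_eval_append)
  qed
  moreover have "X \<subseteq> word_eval G ` lists X"
  proof
    fix a assume "a \<in> X"
    then show "a \<in> word_eval G ` lists X"
      using X by (intro image_eqI[of _ _ "[a]"]) (auto simp: word_eval_def)
  qed
  ultimately show "generated_submonoid G X \<subseteq> word_eval G ` lists X"
    unfolding generated_submonoid_def by blast
next
  have "word_eval G w \<in> N" if "submonoid N G" "X \<subseteq> N" "w \<in> lists X" for N w
    using that(3)
  proof (induction w)
    case Nil
    show ?case using submonoid.one_closed[OF that(1)] by (simp add: word_eval_def)
  next
    case (Cons a w)
    then show ?case
      using that(2) submonoid.m_closed[OF that(1), of a] by (auto simp: word_eval_def)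
  qed
  then show "word_eval G ` lists X \<subseteq> generated_submonoid G X"
    unfolding generated_submonoid_def by blast
qed

text \<open>The word map is always multiplicative and onto the generated submonoid, so injectivity
  is all that remains.\<close>

lemma freely_generatesI:
  assumes X: "X \<subseteq> carrier G" and inj: "inj_on (word_eval G) (lists X)"
  shows "freely_generates_submonoid G X"
  using X inj
  by (auto simp: freely_generates_submonoid_def iso_def hom_def word_monoid_def bij_betw_def
      generated_submonoid_eq word_eval_append[where X = X])

end


subsection \<open>The skew extension\<close>

locale skew_derivation_data = ring R
  for R :: "('a, 'm) ring_scheme" (structure) +
  fixes n :: nat and \<sigma> :: "'a \<Rightarrow> nat \<Rightarrow> nat \<Rightarrow> 'a" and \<delta> :: "'a \<Rightarrow> nat \<Rightarrow> 'a"
  assumes \<sigma>_hom: "\<sigma> \<in> ring_hom R (mat_ring R n)"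
    and \<delta>_der: "right_skew_derivation R n \<sigma> \<delta>"
begin

section \<open>Entrywise rules for \<open>\<sigma>\<close> and \<open>\<delta>\<close>\<close>

definition I :: "nat set" where "I = {1..n}"

lemma finite_I [simp]: "finite I"
  by (simp add: I_def)

lemma \<sigma>_closed: "r \<in> carrier R \<Longrightarrow> i \<in> I \<Longrightarrow> j \<in> I \<Longrightarrow> \<sigma> r i j \<in> carrier R"
  using ring_hom_closed[OF \<sigma>_hom, of r] by (auto simp: mat_ring_def I_def PiE_iff)

lemma \<sigma>_one: "i \<in> I \<Longrightarrow> j \<in> I \<Longrightarrow> \<sigma> \<one> i j = (if i = j then \<one> else \<zero>)"
  using ring_hom_one[OF \<sigma>_hom] by (simp add: mat_ring_def I_def)

lemma \<sigma>_add:
  "r \<in> carrier R \<Longrightarrow> s \<in> carrier R \<Longrightarrow> i \<in> I \<Longrightarrow> j \<in> I \<Longrightarrow> \<sigma> (r \<oplus> s) i j = \<sigma> r i j \<oplus> \<sigma> s i j"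
  using ring_hom_add[OF \<sigma>_hom, of r s] by (simp add: mat_ring_def I_def)

lemma \<sigma>_mult:
  "r \<in> carrier R \<Longrightarrow> s \<in> carrier R \<Longrightarrow> i \<in> I \<Longrightarrow> j \<in> I \<Longrightarrow>
    \<sigma> (r \<otimes> s) i j = (\<Oplus>k\<in>I. \<sigma> r i k \<otimes> \<sigma> s k j)"
  using ring_hom_mult[OF \<sigma>_hom, of r s] by (simp add: mat_ring_def I_def)

lemma \<delta>_add_hom: "\<delta> \<in> add_hom R (row_module R n)"
  using \<delta>_der by (simp add: right_skew_derivation_def add_hom_def)

lemma \<delta>_closed: "r \<in> carrier R \<Longrightarrow> j \<in> I \<Longrightarrow> \<delta> r j \<in> carrier R"
  using add_hom_closed[OF \<delta>_add_hom, of r] by (auto simp: row_module_def I_def PiE_iff)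

lemma \<delta>_add: "r \<in> carrier R \<Longrightarrow> s \<in> carrier R \<Longrightarrow> j \<in> I \<Longrightarrow> \<delta> (r \<oplus> s) j = \<delta> r j \<oplus> \<delta> s j"
  using add_hom_add[OF \<delta>_add_hom, of r s] by (simp add: row_module_def I_def)

lemma \<delta>_mult:
  assumes "r \<in> carrier R" "s \<in> carrier R" "j \<in> I"
  shows "\<delta> (r \<otimes> s) j = (\<Oplus>i\<in>I. \<delta> r i \<otimes> \<sigma> s i j) \<oplus> r \<otimes> \<delta> s j"
proof -
  have "\<delta> (r \<otimes> s) =
      row_mat_mult R n (\<delta> r) (\<sigma> s) \<oplus>\<^bsub>row_module R n\<^esub> r \<odot>\<^bsub>row_module R n\<^esub> \<delta> s"
    using \<delta>_der assms by (simp add: right_skew_derivation_def)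
  then show ?thesis using assms by (simp add: row_module_def row_mat_mult_def I_def)
qed

text \<open>Since \<open>\<sigma> \<one>\<close> is the identity matrix, the derivation rule for
  \<open>\<one> \<otimes> \<one>\<close> makes \<open>\<delta> \<one> j\<close> equal to its own
  double. Needed for \<open>act_one\<close>.\<close>

lemma \<delta>_one:
  assumes "j \<in> I"
  shows "\<delta> \<one> j = \<zero>"
proof -
  have "\<delta> (\<one> \<otimes> \<one>) j = (\<Oplus>i\<in>I. \<delta> \<one> i \<otimes> \<sigma> \<one> i j) \<oplus> \<delta> \<one> j"
    using assms by (subst \<delta>_mult) (simp_all add: \<delta>_closed)
  also have "(\<Oplus>i\<in>I. \<delta> \<one> i \<otimes> \<sigma> \<one> i j) = (\<Oplus>i\<in>I. if j = i then \<delta> \<one> i else \<zero>)"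
    using assms by (intro finsum_cong') (auto simp: \<sigma>_one \<delta>_closed)
  also have "\<dots> = \<delta> \<one> j"
    using assms by (subst finsum_singleton) (auto simp: \<delta>_closed)
  finally have "\<delta> \<one> j \<oplus> \<delta> \<one> j = \<delta> \<one> j" using assms by simp
  then show ?thesis using assms by (simp add: add.l_cancel_one \<delta>_closed)
qed

section \<open>Words and the prefixing operators\<close>

abbreviation D :: "(nat list \<Rightarrow> 'a) ring" where "D \<equiv> finsupp_group R (lists I)"

sublocale D: abelian_group D by (rule finsupp_group_abelian)

lemmas R_abelian = abelian_group_axioms
  and D_abelian = D.abelian_group_axioms

text \<open>Prefixing in coefficient form; \<open>X_single\<close> is the version on
  monomials.\<close>

definition X :: "nat \<Rightarrow> (nat list \<Rightarrow> 'a) \<Rightarrow> nat list \<Rightarrow> 'a" where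
  "X j f = (\<lambda>v. case v of [] \<Rightarrow> \<zero> | i # u \<Rightarrow> if i = j then f u else \<zero>)"

lemma X_single: "X j (single R w r) = single R (j # w) r"
  by (auto simp: X_def single_def split: list.splits)

lemma X_add_hom:
  assumes "j \<in> I"
  shows "X j \<in> add_hom D D"
proof (rule add_homI)
  fix f assume f: "f \<in> carrier D"
  \<comment> \<open>Prefixing carries the support of \<open>f\<close> onto that of
    \<open>X j f\<close>, which is therefore a finite set of words over \<open>I\<close>.\<close>
  have "{v. X j f v \<noteq> \<zero>} = (#) j ` {w. f w \<noteq> \<zero>}"
    by (auto simp: X_def image_iff split: list.splits if_splits)
      (metis list.exhaust)
  then show "X j f \<in> carrier D"
    using f assms by (auto simp: finsupp_carrier subset_iff) (auto simp: X_def split: list.splits)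
next
  fix f g assume "f \<in> carrier D" "g \<in> carrier D"
  then show "X j (f \<oplus>\<^bsub>D\<^esub> g) = X j f \<oplus>\<^bsub>D\<^esub> X j g"
    by (auto simp: finsupp_simps X_def split: list.splits)
qed

lemmas X_closed = add_hom_closed[OF X_add_hom]
  and X_add = add_hom_add[OF X_add_hom]
  and single_D = single_closed[where J = "lists I"]

lemma foldr_X_add_hom: "w \<in> lists I \<Longrightarrow> h \<in> add_hom A D \<Longrightarrow> (\<lambda>s. foldr X w (h s)) \<in> add_hom A D"
  by (induction w) (auto intro: add_hom_comp[OF _ X_add_hom])

text \<open>Each monomial arises from a constant by prefixing its letters, so the constants and the
  operators \<open>X j\<close> generate \<open>D\<close> additively. The \<open>X\<close> case
  allows any \<open>f\<close> in \<open>D\<close>, matching the form of \<open>act_X\<close> and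
  \<open>skew_mult_X\<close>.\<close>

lemma D_induct [consumes 1, case_names const X add]:
  assumes f: "f \<in> carrier D"
    and const: "\<And>s. s \<in> carrier R \<Longrightarrow> P (single R [] s)"
    and X: "\<And>j f. \<lbrakk>j \<in> I; f \<in> carrier D; P f\<rbrakk> \<Longrightarrow> P (X j f)"
    and add: "\<And>f g. \<lbrakk>f \<in> carrier D; g \<in> carrier D; P f; P g\<rbrakk> \<Longrightarrow> P (f \<oplus>\<^bsub>D\<^esub> g)"
  shows "P f"
  using f
proof (induction rule: finsupp_induct)
  case zero
  show ?case using const[OF zero_closed] by (simp only: single_zero[where J = "lists I"])
next
  case (single w r)
  then show ?case
  proof (induction w)
    case Nil
    then show ?case by (simp add: const)
  next
    case (Cons j w)
    then have "P (X j (single R w r))" by (intro X single_D) auto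
    then show ?case by (simp only: X_single)
  qed
qed (rule add)

section \<open>The left action of \<open>R\<close> on \<open>D\<close>\<close>

text \<open>\<open>act_single w r s\<close> is the element \<open>r \<cdot> (w s)\<close>.\<close>

primrec act_single :: "nat list \<Rightarrow> 'a \<Rightarrow> 'a \<Rightarrow> nat list \<Rightarrow> 'a" where
  "act_single [] r s = single R [] (r \<otimes> s)"
| "act_single (j # w) r s =
     (\<Oplus>\<^bsub>D\<^esub>i\<in>I. X i (act_single w (\<sigma> r i j) s)) \<oplus>\<^bsub>D\<^esub> act_single w (\<delta> r j) s"

definition act :: "'a \<Rightarrow> (nat list \<Rightarrow> 'a) \<Rightarrow> nat list \<Rightarrow> 'a" where
  "act r = lift R D (\<lambda>w. act_single w r)"

lemma act_single_add_hom: "w \<in> lists I \<Longrightarrow> r \<in> carrier R \<Longrightarrow> act_single w r \<in> add_hom R D"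
\<comment> \<open>\<open>r\<close> must vary, since the recursion passes to
  \<open>\<sigma> r i j\<close> and \<open>\<delta> r j\<close>.\<close>
proof (induction w arbitrary: r)
  case Nil
  show ?case
    using Nil
    by (intro add_homI) (simp_all add: r_distr single_add[where J = "lists I"] single_D)
next
  case (Cons j w)
  then have "(\<lambda>s. (\<Oplus>\<^bsub>D\<^esub>i\<in>I. X i (act_single w (\<sigma> r i j) s)) \<oplus>\<^bsub>D\<^esub> act_single w (\<delta> r j) s)
      \<in> add_hom R D"
    by (intro add_hom_add_fun add_hom_finsum_fun add_hom_comp[OF _ X_add_hom] D_abelian
        Cons.IH \<sigma>_closed \<delta>_closed) auto
  then show ?case by (simp add: fun_eq_iff[symmetric])
qed

context
  fixes r assumes r: "r \<in> carrier R"
begin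

lemma act_add_hom: "act r \<in> add_hom D D"
  unfolding act_def using r by (intro lift_add_hom D_abelian act_single_add_hom)

lemma act_of_single: "w \<in> lists I \<Longrightarrow> s \<in> carrier R \<Longrightarrow> act r (single R w s) = act_single w r s"
  unfolding act_def
  by (rule lift_single[where J = "lists I"]) (simp_all add: D_abelian act_single_add_hom r)

end

lemmas act_closed = add_hom_closed[OF act_add_hom]
  and act_add = add_hom_add[OF act_add_hom]

lemma act_const:
  "r \<in> carrier R \<Longrightarrow> s \<in> carrier R \<Longrightarrow> act r (single R [] s) = single R [] (r \<otimes> s)"
  by (simp add: act_of_single)

text \<open>On monomials this is the recursion defining \<open>act_single\<close>; both sides are
  additive in \<open>f\<close>, so it holds on all of \<open>D\<close>.\<close>

lemma act_X:
  assumes r: "r \<in> carrier R" and j: "j \<in> I" and f: "f \<in> carrier D"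
  shows "act r (X j f) = (\<Oplus>\<^bsub>D\<^esub>i\<in>I. X i (act (\<sigma> r i j) f)) \<oplus>\<^bsub>D\<^esub> act (\<delta> r j) f"
proof (rule finsupp_add_hom_eqI[OF D_abelian _ _ _ f])
  show "(\<lambda>f. act r (X j f)) \<in> add_hom D D"
    using r j by (intro add_hom_comp[OF X_add_hom act_add_hom])
  show "(\<lambda>f. (\<Oplus>\<^bsub>D\<^esub>i\<in>I. X i (act (\<sigma> r i j) f)) \<oplus>\<^bsub>D\<^esub> act (\<delta> r j) f) \<in> add_hom D D"
    using r j by (intro add_hom_add_fun add_hom_finsum_fun add_hom_comp[OF _ X_add_hom] D_abelian
        act_add_hom \<sigma>_closed \<delta>_closed)
next
  fix w s assume w: "w \<in> lists I" and s: "s \<in> carrier R"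
  have "(\<Oplus>\<^bsub>D\<^esub>i\<in>I. X i (act (\<sigma> r i j) (single R w s))) = (\<Oplus>\<^bsub>D\<^esub>i\<in>I. X i (act_single w (\<sigma> r i j) s))"
    using r j w s
    by (intro D.finsum_cong')
      (auto simp: act_of_single \<sigma>_closed intro!: X_closed add_hom_closed[OF act_single_add_hom])
  then show "act r (X j (single R w s)) =
      (\<Oplus>\<^bsub>D\<^esub>i\<in>I. X i (act (\<sigma> r i j) (single R w s))) \<oplus>\<^bsub>D\<^esub> act (\<delta> r j) (single R w s)"
    using r j w s by (simp add: X_single act_of_single \<delta>_closed)
qed

lemma X_act_closed:
  "r \<in> carrier R \<Longrightarrow> j \<in> I \<Longrightarrow> f \<in> carrier D \<Longrightarrow> (\<lambda>i. X i (act (\<sigma> r i j) f)) \<in> I \<rightarrow> carrier D"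
  by (auto intro!: X_closed act_closed \<sigma>_closed)

text \<open>Additivity in the scalar passes through the recursion because \<open>\<sigma>\<close>
  and \<open>\<delta>\<close> are additive.\<close>

lemma act_add_left:
  assumes "f \<in> carrier D" "r \<in> carrier R" "s \<in> carrier R"
  shows "act (r \<oplus> s) f = act r f \<oplus>\<^bsub>D\<^esub> act s f"
  using assms
proof (induction arbitrary: r s rule: D_induct)
  case (const t)
  then show ?case by (simp add: act_const l_distr single_add[where J = "lists I"])
next
  case (X j f)
  have "(\<Oplus>\<^bsub>D\<^esub>i\<in>I. X i (act (\<sigma> (r \<oplus> s) i j) f))
      = (\<Oplus>\<^bsub>D\<^esub>i\<in>I. X i (act (\<sigma> r i j) f) \<oplus>\<^bsub>D\<^esub> X i (act (\<sigma> s i j) f))"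
    using X by (intro D.finsum_cong') (auto simp: \<sigma>_add \<sigma>_closed X_add act_closed X_closed)
  then show ?case
    using X by (simp add: act_X D.finsum_addf X_act_closed \<delta>_add \<delta>_closed act_closed D.a_ac
        D.finsum_closed)
next
  case (add f g)
  then show ?case by (simp add: act_add act_closed D.a_ac)
qed

lemma act_add_hom_left: "f \<in> carrier D \<Longrightarrow> (\<lambda>r. act r f) \<in> add_hom R D"
  by (rule add_homI) (auto simp: act_closed act_add_left)

lemma act_zero: "f \<in> carrier D \<Longrightarrow> act \<zero> f = \<zero>\<^bsub>D\<^esub>"
  by (rule add_hom_zero[OF R_abelian D_abelian act_add_hom_left])

text \<open>With \<open>\<sigma> \<one>\<close> the identity matrix and
  \<open>\<delta> \<one>\<close> zero, the formula \<open>act_X\<close> collapses to its term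
  \<open>i = j\<close>.\<close>

lemma act_one: "f \<in> carrier D \<Longrightarrow> act \<one> f = f"
proof (induction rule: D_induct)
  case (X j f)
  have "(\<Oplus>\<^bsub>D\<^esub>i\<in>I. X i (act (\<sigma> \<one> i j) f)) = (\<Oplus>\<^bsub>D\<^esub>i\<in>I. if j = i then X i f else \<zero>\<^bsub>D\<^esub>)"
    using X by (intro D.finsum_cong')
      (auto simp: \<sigma>_one act_zero X_closed add_hom_zero[OF D_abelian D_abelian X_add_hom])
  also have "\<dots> = X j f"
    using X by (intro D.finsum_singleton) (auto simp: X_closed)
  finally show ?case
    using X by (simp add: act_X \<delta>_one act_zero X_closed)
qed (simp_all add: act_const act_add)

text \<open>Expand the left side on \<open>X j f\<close> by \<open>act_X\<close> twice. The terms
  with a prefix \<open>X k\<close> assemble to \<open>\<sigma> (r \<otimes> s) k j\<close> by the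
  matrix product, the others to \<open>\<delta> (r \<otimes> s) j\<close> by the derivation
  rule.\<close>

lemma act_act:
  assumes "f \<in> carrier D" "r \<in> carrier R" "s \<in> carrier R"
  shows "act r (act s f) = act (r \<otimes> s) f"
  using assms
proof (induction arbitrary: r s rule: D_induct)
  case (const t)
  then show ?case by (simp add: act_const m_assoc)
next
  case (X j f)
  note cl = X_closed act_closed \<sigma>_closed \<delta>_closed
  \<comment> \<open>The outer scalar moves past \<open>X i\<close>, and the induction hypothesis
    merges the two scalars then acting on \<open>f\<close>.\<close>
  have "act r (X i (act (\<sigma> s i j) f))
      = (\<Oplus>\<^bsub>D\<^esub>k\<in>I. X k (act (\<sigma> r k i \<otimes> \<sigma> s i j) f)) \<oplus>\<^bsub>D\<^esub> act (\<delta> r i \<otimes> \<sigma> s i j) f"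
    if i: "i \<in> I" for i
  proof -
    have "(\<Oplus>\<^bsub>D\<^esub>k\<in>I. X k (act (\<sigma> r k i) (act (\<sigma> s i j) f)))
        = (\<Oplus>\<^bsub>D\<^esub>k\<in>I. X k (act (\<sigma> r k i \<otimes> \<sigma> s i j) f))"
      using X i by (intro D.finsum_cong') (auto simp: cl X.IH)
    then show ?thesis using X i by (simp add: act_X cl X.IH)
  qed
  moreover have "act r (act s (X j f))
      = (\<Oplus>\<^bsub>D\<^esub>i\<in>I. act r (X i (act (\<sigma> s i j) f))) \<oplus>\<^bsub>D\<^esub> act (r \<otimes> \<delta> s j) f"
    using X by (simp add: act_X act_add D.finsum_closed X_act_closed cl X.IH
        add_hom_finsum[OF D_abelian D_abelian act_add_hom])
  ultimately have "act r (act s (X j f))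
      = (\<Oplus>\<^bsub>D\<^esub>i\<in>I. (\<Oplus>\<^bsub>D\<^esub>k\<in>I. X k (act (\<sigma> r k i \<otimes> \<sigma> s i j) f)) \<oplus>\<^bsub>D\<^esub> act (\<delta> r i \<otimes> \<sigma> s i j) f)
        \<oplus>\<^bsub>D\<^esub> act (r \<otimes> \<delta> s j) f"
    using X by (simp add: cl D.finsum_closed Pi_iff cong: D.finsum_cong)
  \<comment> \<open>Terms that keep a prefix are separated from those that have lost it.\<close>
  also have "\<dots> = (\<Oplus>\<^bsub>D\<^esub>i\<in>I. \<Oplus>\<^bsub>D\<^esub>k\<in>I. X k (act (\<sigma> r k i \<otimes> \<sigma> s i j) f))
        \<oplus>\<^bsub>D\<^esub> ((\<Oplus>\<^bsub>D\<^esub>i\<in>I. act (\<delta> r i \<otimes> \<sigma> s i j) f) \<oplus>\<^bsub>D\<^esub> act (r \<otimes> \<delta> s j) f)"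
    using X by (subst D.finsum_addf) (auto simp: cl D.a_assoc intro!: D.finsum_closed)
  also have "(\<Oplus>\<^bsub>D\<^esub>i\<in>I. \<Oplus>\<^bsub>D\<^esub>k\<in>I. X k (act (\<sigma> r k i \<otimes> \<sigma> s i j) f))
        = (\<Oplus>\<^bsub>D\<^esub>k\<in>I. \<Oplus>\<^bsub>D\<^esub>i\<in>I. X k (act (\<sigma> r k i \<otimes> \<sigma> s i j) f))"
    using X by (intro D.finsum_swap) (auto simp: cl)
  \<comment> \<open>For fixed \<open>k\<close>, additivity in the scalar collects the sum over
    \<open>i\<close> into an entry of the matrix product of \<open>\<sigma> r\<close> and
    \<open>\<sigma> s\<close>.\<close>
  also have "\<dots> = (\<Oplus>\<^bsub>D\<^esub>k\<in>I. X k (act (\<sigma> (r \<otimes> s) k j) f))"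
  proof (rule D.finsum_cong')
    fix k assume k: "k \<in> I"
    have "X k (act (\<Oplus>i\<in>I. \<sigma> r k i \<otimes> \<sigma> s i j) f) = (\<Oplus>\<^bsub>D\<^esub>i\<in>I. X k (act (\<sigma> r k i \<otimes> \<sigma> s i j) f))"
      using X k
      by (intro add_hom_finsum[OF R_abelian D_abelian add_hom_comp[OF act_add_hom_left X_add_hom]])
        (auto simp: cl)
    then show "(\<Oplus>\<^bsub>D\<^esub>i\<in>I. X k (act (\<sigma> r k i \<otimes> \<sigma> s i j) f)) = X k (act (\<sigma> (r \<otimes> s) k j) f)"
      using X k by (simp add: \<sigma>_mult)
  qed (use X in \<open>auto simp: cl\<close>)
  also have "(\<Oplus>\<^bsub>D\<^esub>i\<in>I. act (\<delta> r i \<otimes> \<sigma> s i j) f) = act (\<Oplus>i\<in>I. \<delta> r i \<otimes> \<sigma> s i j) f"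
    using X
    by (intro add_hom_finsum[OF R_abelian D_abelian act_add_hom_left, symmetric]) (auto simp: cl)
  \<comment> \<open>The two scalars are exactly the two terms of the derivation rule for
    \<open>r \<otimes> s\<close>.\<close>
  also have "\<dots> \<oplus>\<^bsub>D\<^esub> act (r \<otimes> \<delta> s j) f = act (\<delta> (r \<otimes> s) j) f"
    using X by (subst \<delta>_mult, simp_all, subst act_add_left) (auto simp: cl intro!: finsum_closed)
  finally show ?case using X by (simp add: act_X)
next
  case (add f g)
  then show ?case by (simp add: act_add act_closed)
qed

section \<open>The product on \<open>D\<close>\<close>

definition skew_mult :: "(nat list \<Rightarrow> 'a) \<Rightarrow> (nat list \<Rightarrow> 'a) \<Rightarrow> nat list \<Rightarrow> 'a" where
  "skew_mult f g = lift R D (\<lambda>w s. foldr X w (act s g)) f"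

lemma skew_mult_add_hom_left:
  assumes "g \<in> carrier D"
  shows "(\<lambda>f. skew_mult f g) \<in> add_hom D D"
  unfolding skew_mult_def
  by (rule lift_add_hom[OF D_abelian]) (rule foldr_X_add_hom[OF _ act_add_hom_left[OF assms]])

lemma skew_mult_of_single:
  assumes "g \<in> carrier D" "w \<in> lists I" "s \<in> carrier R"
  shows "skew_mult (single R w s) g = foldr X w (act s g)"
  unfolding skew_mult_def using assms
  by (intro lift_single[where J = "lists I"] D_abelian foldr_X_add_hom act_add_hom_left)

lemmas skew_mult_closed = add_hom_closed[OF skew_mult_add_hom_left]
  and skew_mult_add_left = add_hom_add[OF skew_mult_add_hom_left]

lemma skew_mult_const: "g \<in> carrier D \<Longrightarrow> s \<in> carrier R \<Longrightarrow> skew_mult (single R [] s) g = act s g"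
  by (simp add: skew_mult_of_single)

text \<open>Prefixing commutes with right multiplication: on a monomial the word merely gains one
  letter, and both sides are additive in \<open>f\<close>.\<close>

lemma skew_mult_X:
  assumes g: "g \<in> carrier D" and j: "j \<in> I" and f: "f \<in> carrier D"
  shows "skew_mult (X j f) g = X j (skew_mult f g)"
proof (rule finsupp_add_hom_eqI[OF D_abelian _ _ _ f])
  show "(\<lambda>f. skew_mult (X j f) g) \<in> add_hom D D"
    using g j by (intro add_hom_comp[OF X_add_hom skew_mult_add_hom_left])
  show "(\<lambda>f. X j (skew_mult f g)) \<in> add_hom D D"
    using g j by (intro add_hom_comp[OF skew_mult_add_hom_left X_add_hom])
qed (use g j in \<open>simp add: X_single skew_mult_of_single\<close>)

text \<open>Additivity in the left factor is built into \<open>lift\<close>; in the right factor it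
  comes from that of \<open>act\<close> and \<open>X\<close>, by induction on
  \<open>f\<close>.\<close>

lemma skew_mult_add_right:
  assumes "f \<in> carrier D" "g \<in> carrier D" "h \<in> carrier D"
  shows "skew_mult f (g \<oplus>\<^bsub>D\<^esub> h) = skew_mult f g \<oplus>\<^bsub>D\<^esub> skew_mult f h"
  using assms
proof (induction rule: D_induct)
  case (add f f')
  then show ?case by (simp add: skew_mult_add_left skew_mult_closed D.a_ac)
qed (simp_all add: skew_mult_const skew_mult_X act_add X_add skew_mult_closed)

text \<open>Associativity with a constant as first factor. Constants \<open>f\<close> reduce to
  \<open>act_act\<close>; for \<open>X j f\<close> both sides expand by \<open>act_X\<close>, and
  the induction hypothesis is applied to the new scalars \<open>\<sigma> r i j\<close> and
  \<open>\<delta> r j\<close>.\<close>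

lemma skew_mult_act:
  assumes "f \<in> carrier D" "g \<in> carrier D" "r \<in> carrier R"
  shows "skew_mult (act r f) g = act r (skew_mult f g)"
  using assms
proof (induction arbitrary: r rule: D_induct)
  case (const s)
  then show ?case by (simp add: act_const skew_mult_const act_act)
next
  case (X j f)
  have "skew_mult (\<Oplus>\<^bsub>D\<^esub>i\<in>I. X i (act (\<sigma> r i j) f)) g = (\<Oplus>\<^bsub>D\<^esub>i\<in>I. skew_mult (X i (act (\<sigma> r i j) f)) g)"
    using X by (intro add_hom_finsum[OF D_abelian D_abelian skew_mult_add_hom_left] X_act_closed) auto
  also have "\<dots> = (\<Oplus>\<^bsub>D\<^esub>i\<in>I. X i (act (\<sigma> r i j) (skew_mult f g)))"
    using X by (intro D.finsum_cong')
      (auto simp: skew_mult_X X.IH act_closed \<sigma>_closed skew_mult_closed X_closed)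
  finally show ?case
    using X by (simp add: act_X skew_mult_add_left skew_mult_X skew_mult_closed X.IH act_closed \<delta>_closed
        D.finsum_closed X_act_closed)
next
  case (add f f')
  then show ?case by (simp add: act_add act_closed skew_mult_add_left skew_mult_closed)
qed

text \<open>Induction on \<open>f\<close>: constants are \<open>skew_mult_act\<close>, prefixes come
  out by \<open>skew_mult_X\<close>, and sums split by left additivity.\<close>

lemma skew_mult_assoc:
  assumes "f \<in> carrier D" "g \<in> carrier D" "h \<in> carrier D"
  shows "skew_mult (skew_mult f g) h = skew_mult f (skew_mult g h)"
  using assms
  by (induction rule: D_induct)
    (simp_all add: skew_mult_const skew_mult_X skew_mult_act skew_mult_add_left skew_mult_closed)

lemma skew_mult_one: "f \<in> carrier D \<Longrightarrow> skew_mult f (single R [] \<one>) = f"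
  by (induction rule: D_induct)
    (simp_all add: skew_mult_const skew_mult_X act_const skew_mult_add_left single_D)

lemma one_times: "f \<in> carrier D \<Longrightarrow> skew_mult (single R [] \<one>) f = f"
  by (simp add: skew_mult_const act_one)

section \<open>The ring \<open>S\<close> and its monomials\<close>

definition S :: "(nat list \<Rightarrow> 'a) ring" where
  "S = D\<lparr>mult := skew_mult, one := single R [] \<one>\<rparr>"

lemma S_simps [simp]:
  "carrier S = carrier D" "zero S = zero D" "add S = add D" "finsum S = finsum D"
  "f \<otimes>\<^bsub>S\<^esub> g = skew_mult f g" "\<one>\<^bsub>S\<^esub> = single R [] \<one>"
  by (simp_all add: S_def finsum_def)

lemma ring_S: "ring S"
proof (rule ringI)
  show "abelian_group S"
    using D_abelian by (simp add: abelian_group_def abelian_monoid_def abelian_group_axioms_def)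
  show "monoid S"
    by (rule monoidI) (simp_all add: skew_mult_closed skew_mult_assoc skew_mult_one one_times single_D)
qed (simp_all add: skew_mult_add_left skew_mult_add_right)

lemma single_ring_hom: "single R [] \<in> ring_hom R S"
  by (rule ring_hom_memI)
    (simp_all add: single_D skew_mult_const act_const single_add[where J = "lists I"])

lemma foldr_X_single: "foldr X w (single R v r) = single R (w @ v) r"
  by (induction w) (simp_all add: X_single)

text \<open>Identifies the summands in \<open>right_module_basis\<close> with the monomials of the
  expansion of an element.\<close>

lemma monomial_times:
  assumes "w \<in> lists I" "r \<in> carrier R"
  shows "skew_mult (single R w \<one>) (single R [] r) = single R w r"
proof -
  have "skew_mult (single R w \<one>) (single R [] r) = foldr X w (single R [] r)"
    using assms by (subst skew_mult_of_single) (simp_all only: act_one single_D lists.Nil one_closed)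
  then show ?thesis by (simp add: foldr_X_single)
qed

lemma generator_times:
  assumes "j \<in> I" "f \<in> carrier D"
  shows "skew_mult (single R [j] \<one>) f = X j f"
  using assms by (simp add: skew_mult_of_single act_one)

text \<open>Multiplying by a generator on the left prefixes its letter. This serves both freeness
  and the description of the generated submonoid.\<close>

lemma word_eval_S: "w \<in> lists I \<Longrightarrow> word_eval S (map (\<lambda>j. single R [j] \<one>) w) = single R w \<one>"
proof (induction w)
  case (Cons j w)
  then show ?case by (auto simp: word_eval_def generator_times single_D X_single)
qed (simp add: word_eval_def)

text \<open>This is \<open>act_X\<close> at the unit, where \<open>act t\<close> returns the
  constant \<open>t\<close>.\<close>

lemma commutation:
  assumes r: "r \<in> carrier R" and j: "j \<in> I"
  shows "skew_mult (single R [] r) (single R [j] \<one>) =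
    (\<Oplus>\<^bsub>D\<^esub>i\<in>I. skew_mult (single R [i] \<one>) (single R [] (\<sigma> r i j))) \<oplus>\<^bsub>D\<^esub> single R [] (\<delta> r j)"
proof -
  have "skew_mult (single R [] r) (single R [j] \<one>) = act r (X j (single R [] \<one>))"
    using assms by (simp add: skew_mult_const X_single single_D)
  also have "\<dots> = (\<Oplus>\<^bsub>D\<^esub>i\<in>I. X i (act (\<sigma> r i j) (single R [] \<one>))) \<oplus>\<^bsub>D\<^esub> single R [] (\<delta> r j)"
    using assms by (simp add: act_X single_D act_const \<delta>_closed)
  also have "(\<Oplus>\<^bsub>D\<^esub>i\<in>I. X i (act (\<sigma> r i j) (single R [] \<one>)))
      = (\<Oplus>\<^bsub>D\<^esub>i\<in>I. skew_mult (single R [i] \<one>) (single R [] (\<sigma> r i j)))"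
    using assms by (intro D.finsum_cong')
      (auto simp: act_const generator_times single_D \<sigma>_closed intro!: X_closed)
  finally show ?thesis .
qed

text \<open>Coordinates in this basis are the values of the function at words;
  \<open>\<one> \<noteq> \<zero>\<close> lets a basis element determine its word.\<close>

lemma monomial_basis:
  assumes "\<one> \<noteq> \<zero>"
  shows "right_module_basis R S (single R []) ((\<lambda>w. single R w \<one>) ` lists I)"
proof -
  let ?E = "\<lambda>w :: nat list. single R w \<one>"
  have inj: "inj ?E" using assms by (auto simp: inj_def single_def fun_eq_iff split: if_splits)
  \<comment> \<open>Sums over basis elements become sums over words, where coefficients can be read
    off.\<close>
  have sum: "(\<Oplus>\<^bsub>D\<^esub>b\<in>?E ` A. skew_mult b (single R [] (c b))) = (\<Oplus>\<^bsub>D\<^esub>w\<in>A. single R w (c (?E w)))"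
    if A: "A \<subseteq> lists I" and c: "c \<in> ?E ` A \<rightarrow> carrier R" for A c
  proof -
    have "(\<Oplus>\<^bsub>D\<^esub>b\<in>?E ` A. skew_mult b (single R [] (c b)))
        = (\<Oplus>\<^bsub>D\<^esub>w\<in>A. skew_mult (?E w) (single R [] (c (?E w))))"
      using A c inj
      by (intro D.finsum_reindex) (auto intro!: skew_mult_closed single_D intro: inj_on_subset)
    also have "\<dots> = (\<Oplus>\<^bsub>D\<^esub>w\<in>A. single R w (c (?E w)))"
    proof (rule D.finsum_cong')
      show "skew_mult (?E w) (single R [] (c (?E w))) = single R w (c (?E w))" if "w \<in> A" for w
        using A c that by (intro monomial_times) auto
      show "(\<lambda>w. single R w (c (?E w))) \<in> A \<rightarrow> carrier D"
        using A c by (auto intro!: single_D)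
    qed simp
    finally show ?thesis .
  qed
  have "\<exists>F c. finite F \<and> F \<subseteq> ?E ` lists I \<and> c \<in> F \<rightarrow> carrier R \<and>
      f = (\<Oplus>\<^bsub>D\<^esub>b\<in>F. skew_mult b (single R [] (c b)))" if f: "f \<in> carrier D" for f
  proof (intro exI conjI)
    \<comment> \<open>The coefficient of a basis element is the value of \<open>f\<close> at the
      word it comes from.\<close>
    let ?c = "\<lambda>b. f (inv_into UNIV ?E b)"
    show "finite (?E ` {w. f w \<noteq> \<zero>})" "?E ` {w. f w \<noteq> \<zero>} \<subseteq> ?E ` lists I"
      "?c \<in> ?E ` {w. f w \<noteq> \<zero>} \<rightarrow> carrier R"
      using f by (auto simp: finsupp_carrier)
    then have "(\<Oplus>\<^bsub>D\<^esub>b\<in>?E ` {w. f w \<noteq> \<zero>}. skew_mult b (single R [] (?c b)))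
        = (\<Oplus>\<^bsub>D\<^esub>w\<in>{w. f w \<noteq> \<zero>}. single R w (f w))"
      using f inv_f_f[OF inj] by (subst sum) (simp_all add: finsupp_carrier)
    then show "f = (\<Oplus>\<^bsub>D\<^esub>b\<in>?E ` {w. f w \<noteq> \<zero>}. skew_mult b (single R [] (?c b)))"
      using finsupp_expansion[OF f] by (rule trans[OF _ sym, rotated])
  qed
  moreover have "\<forall>b\<in>F. c b = \<zero>"
    if F: "finite F" "F \<subseteq> ?E ` lists I" and c: "c \<in> F \<rightarrow> carrier R"
      and zero: "(\<Oplus>\<^bsub>D\<^esub>b\<in>F. skew_mult b (single R [] (c b))) = \<zero>\<^bsub>D\<^esub>" for F c
  proof -
    obtain A where A: "A \<subseteq> lists I" "finite A" "F = ?E ` A"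
      using finite_subset_image[OF F] by blast
    have "c (?E w) = \<zero>" if "w \<in> A" for w
    proof -
      \<comment> \<open>Evaluating the vanishing combination at \<open>w\<close> isolates the
        coefficient of that word.\<close>
      have "c (?E w) = (\<Oplus>\<^bsub>D\<^esub>w\<in>A. single R w (c (?E w))) w"
        using A c that by (subst finsum_single_apply) auto
      also have "\<dots> = \<zero>" using A c zero sum[of A c] by (simp add: finsupp_simps)
      finally show ?thesis .
    qed
    then show ?thesis using A by auto
  qed
  ultimately show ?thesis
    unfolding right_module_basis_def by (auto intro!: single_D)
qed

end

section \<open>Existence of the skew extension\<close>

theorem theorem1p1:
  fixes R :: "('a, 'm) ring_scheme" and n :: nat
    and \<sigma> :: "'a \<Rightarrow> nat \<Rightarrow> nat \<Rightarrow> 'a" and \<delta> :: "'a \<Rightarrow> nat \<Rightarrow> 'a"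
  assumes "ring R" and "\<one>\<^bsub>R\<^esub> \<noteq> \<zero>\<^bsub>R\<^esub>"
    and "n > 0"
    and "\<sigma> \<in> ring_hom R (mat_ring R n)"
    and "right_skew_derivation R n \<sigma> \<delta>"
  shows "\<exists>(S :: (nat list \<Rightarrow> 'a) ring) (l :: 'a \<Rightarrow> nat list \<Rightarrow> 'a) (x :: nat \<Rightarrow> nat list \<Rightarrow> 'a).
           free_skew_extension R n \<sigma> \<delta> S l x"
proof -
  interpret R: ring R by fact
  interpret K: skew_derivation_data R n \<sigma> \<delta>
    using assms by unfold_locales
  interpret S: ring K.S by (rule K.ring_S)
  \<comment> \<open>The generators are the one-letter words with coefficient one.\<close>
  let ?x = "\<lambda>j. single R [j] \<one>\<^bsub>R\<^esub>"
  have x_closed: "?x ` K.I \<subseteq> carrier K.S" by (auto intro!: K.single_D)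
  have lists_x: "lists (?x ` K.I) = map ?x ` lists K.I" by (rule lists_image)
  \<comment> \<open>Here nontriviality of \<open>R\<close> enters: over the zero ring all monomials
    coincide.\<close>
  have inj: "single R v \<one>\<^bsub>R\<^esub> = single R w \<one>\<^bsub>R\<^esub> \<Longrightarrow> v = w" for v w :: "nat list"
    using assms(2) by (auto simp: single_def fun_eq_iff split: if_splits)
  have "inj_on (word_eval K.S) (lists (?x ` K.I))"
    unfolding lists_x
  proof (rule inj_onI)
    fix a b assume "a \<in> map ?x ` lists K.I" "b \<in> map ?x ` lists K.I"
      and eq: "word_eval K.S a = word_eval K.S b"
    then obtain v w where "v \<in> lists K.I" "w \<in> lists K.I" "a = map ?x v" "b = map ?x w"
      by blast
    then show "a = b" using eq inj[of v w] by (simp add: K.word_eval_S)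
  qed
  then have free: "freely_generates_submonoid K.S (?x ` K.I)"
    using x_closed by (rule S.freely_generatesI[rotated])
  \<comment> \<open>Products of generators are exactly the monomials with coefficient one, so the
    basis already found is the one required.\<close>
  have "generated_submonoid K.S (?x ` K.I) = (\<lambda>w. single R w \<one>\<^bsub>R\<^esub>) ` lists K.I"
    unfolding S.generated_submonoid_eq[OF x_closed] lists_x image_image
    by (intro image_cong) (simp_all add: K.word_eval_S)
  then have basis: "right_module_basis R K.S (single R []) (generated_submonoid K.S (?x ` K.I))"
    using K.monomial_basis[OF assms(2)] by simp
  have "free_skew_extension R n \<sigma> \<delta> K.S (single R []) ?x"
    unfolding free_skew_extension_def R_ring_def K.I_def[symmetric]
    using x_closed free basis K.single_ring_hom K.commutation
    by (auto simp: R.ring_axioms S.ring_axioms inj_on_def dest: inj)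
  then show ?thesis by blast
qed

end
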